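(* $33$ non-overlapping unit squares cannot be packed in a square of side length less than $6$.
   Context: All squares are in the Euclidean plane. Unit squares (closed squares of side length $1$) may be placed in arbitrary position and with arbitrary orientation (rotations are allowed). They are non-overlapping if their interiors are pairwise disjoint, and they are packed in a (closed) square $S$ if each of them is a subset of $S$. *)

theory Defs
  imports "HOL-Analysis.Analysis"
begin

text \<open>
  A closed square of side length \<open>a\<close> in arbitrary position and orientation: \<open>c\<close> is a corner and
  \<open>u\<close>, \<open>v\<close> are the orthonormal directions of the two sides at \<open>c\<close>. Degenerate squares
  (\<open>a \<le> 0\<close>) are excluded.
\<close>

definition is_square :: "real \<Rightarrow> (real ^ 2) set \<Rightarrow> bool" where
  "is_square a Q \<longleftrightarrow> a > 0 \<and>
     (\<exists>c u v. norm u = 1 \<and> norm v = 1 \<and> u \<bullet> v = 0 \<and>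
       Q = {c + x *\<^sub>R u + y *\<^sub>R v | x y. x \<in> {0..a} \<and> y \<in> {0..a}})"

abbreviation is_unit_square :: "(real ^ 2) set \<Rightarrow> bool" where
  "is_unit_square \<equiv> is_square 1"

definition non_overlapping :: "(real ^ 2) set set \<Rightarrow> bool" where
  "non_overlapping P \<longleftrightarrow> pairwise (\<lambda>A B. interior A \<inter> interior B = {}) P"

definition packed_in :: "(real ^ 2) set set \<Rightarrow> (real ^ 2) set \<Rightarrow> bool" where
  "packed_in P S \<longleftrightarrow> (\<forall>Q\<in>P. Q \<subseteq> S)"

end

theory Submission
  imports Defs
begin

text \<open>
  Enlarging the picture by the factor \<open>6/s > 1\<close> and shrinking the enlarged squares back to side \<open>1\<close>
  gives pairwise disjoint closed unit squares in \<open>[0,6]\<^sup>2\<close>. Take six horizontal lines with heights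
  \<open>0.914, 1.622, 2.488, 3.354, 4.22, 5.086\<close>, and put \<open>5\<close> and \<open>6\<close> points on them alternately, with
  spacing at most \<open>1\<close>. The resulting triangulation has edges of length at most \<open>1\<close>, so every unit
  square contains one of these \<open>33\<close> points. The gap between the two lowest lines is only \<open>0.708\<close>.
  If both of them carry the five points \<open>1,\<dots>,5\<close>, only \<open>32\<close> points are used, and a square that avoids
  them all has its centre in one of the four rectangles \<open>[i,i+1] \<times> [0.914,1.622]\<close>. Among \<open>33\<close> disjoint
  squares there is such an avoiding square. It is wedged between the corners of its rectangle, which
  forces it to contain two points of one of the \<open>33\<close>-point sets with the coordinates exchanged.
  Then there are at most \<open>32\<close> squares, a contradiction.
\<close>

section \<open>Unit squares in coordinates and their symmetries\<close>

text \<open>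
  The closed unit square with centre \<open>(x, y)\<close> and side directions \<open>(c, s)\<close>, \<open>(-s, c)\<close> contains the
  point \<open>(p, q)\<close>. Up to a quarter turn, which does not change the square, \<open>c\<close> and \<open>s\<close> are nonnegative.
\<close>

definition hit :: "real \<Rightarrow> real \<Rightarrow> real \<Rightarrow> real \<Rightarrow> real \<Rightarrow> real \<Rightarrow> bool" where
  "hit x y c s p q \<longleftrightarrow> \<bar>c * (p - x) + s * (q - y)\<bar> \<le> 1/2 \<and> \<bar>c * (q - y) - s * (p - x)\<bar> \<le> 1/2"

definition direction :: "real \<Rightarrow> real \<Rightarrow> bool" where
  "direction c s \<longleftrightarrow> 0 \<le> c \<and> 0 \<le> s \<and> c\<^sup>2 + s\<^sup>2 = 1"

lemma hit_transpose: "hit y x s c q p \<longleftrightarrow> hit x y c s p q"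
  unfolding hit_def by (simp add: add.commute abs_minus_commute)

text \<open>Reflection turns the direction \<open>(c, s)\<close> into \<open>(-c, s)\<close>, and a
  quarter turn takes this to \<open>(s, c)\<close>. So \<open>c\<close> and \<open>s\<close> are
  exchanged and stay nonnegative.\<close>

lemma hit_reflect_x: "hit (k - x) y s c (k - p) q \<longleftrightarrow> hit x y c s p q"
proof -
  have "s * (k - p - (k - x)) + c * (q - y) = c * (q - y) - s * (p - x)"
    "s * (q - y) - c * (k - p - (k - x)) = c * (p - x) + s * (q - y)" by algebra+
  then show ?thesis unfolding hit_def by metis
qed

lemma hit_reflect_y: "hit x (k - y) s c p (k - q) \<longleftrightarrow> hit x y c s p q"
  using hit_reflect_x[of k y x c s q p] hit_transpose by metis

lemma direction_swap: "direction s c \<longleftrightarrow> direction c s"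
  unfolding direction_def by auto

text \<open>The square has width \<open>c + s\<close> in both coordinate directions. The excess
  \<open>w = c + s - 1\<close> is at most \<open>sqrt 2 - 1\<close>, here replaced by a rational
  upper bound, and the formula for \<open>c * s\<close> lets later estimates be written in
  \<open>w\<close>.\<close>

lemma direction_bounds:
  assumes "direction c s"
  shows "0 \<le> c" "0 \<le> s" "c \<le> 1" "s \<le> 1" "1 \<le> c + s" "c * s \<le> 1/2"
    "c + s - 1 \<le> 207107/500000" "c * s = (c + s - 1) + (c + s - 1)\<^sup>2 / 2" "c\<^sup>2 = 1 - s\<^sup>2"
proof -
  have nn: "0 \<le> c" "0 \<le> s" and q: "c\<^sup>2 + s\<^sup>2 = 1" using assms by (auto simp: direction_def)
  show "0 \<le> c" "0 \<le> s" by fact+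
  show le: "c \<le> 1" "s \<le> 1"
    using q abs_square_le_1[of c] abs_square_le_1[of s] zero_le_power2[of c] zero_le_power2[of s] nn by linarith+
  have "c * c \<le> c" "s * s \<le> s" using le nn by (auto simp: mult_left_le)
  then show "1 \<le> c + s" using q by (simp add: power2_eq_square)
  have "0 \<le> (c - s)\<^sup>2" by simp
  then show cs: "c * s \<le> 1/2" using q by (simp add: power2_eq_square algebra_simps)
  have "(c + s)\<^sup>2 \<le> 2" using q cs by (simp add: power2_eq_square algebra_simps)
  also have "2 \<le> (707107/500000 :: real)\<^sup>2" by (simp add: power2_eq_square)
  finally have "c + s \<le> 707107/500000" by (rule power2_le_imp_le) simp
  then show "c + s - 1 \<le> 207107/500000" by simp
  show "c * s = (c + s - 1) + (c + s - 1)\<^sup>2 / 2" using q by (simp add: power2_eq_square field_simps)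
  show "c\<^sup>2 = 1 - s\<^sup>2" using q by simp
qed

section \<open>Triangles with sides at most 1 around the centre of a square\<close>

lemma frame_le:
  assumes "c\<^sup>2 + s\<^sup>2 = (1::real)" "a\<^sup>2 + b\<^sup>2 \<le> r\<^sup>2" "0 \<le> r"
  shows "\<bar>c * a + s * b\<bar> \<le> r" "\<bar>c * b - s * a\<bar> \<le> r"
proof -
  have "(c * a + s * b)\<^sup>2 + (c * b - s * a)\<^sup>2 = (c\<^sup>2 + s\<^sup>2) * (a\<^sup>2 + b\<^sup>2)"
    by (simp add: power2_eq_square algebra_simps)
  then have "(c * a + s * b)\<^sup>2 + (c * b - s * a)\<^sup>2 \<le> r\<^sup>2" using assms by simp
  then have "(c * a + s * b)\<^sup>2 \<le> r\<^sup>2" "(c * b - s * a)\<^sup>2 \<le> r\<^sup>2"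
    using zero_le_power2[of "c * a + s * b"] zero_le_power2[of "c * b - s * a"] by linarith+
  then show "\<bar>c * a + s * b\<bar> \<le> r" "\<bar>c * b - s * a\<bar> \<le> r"
    using assms(3) by (simp_all add: abs_le_square_iff[symmetric])
qed

text \<open>The vertices of a triangle are given in the frame of the square, with its centre as
  origin. Some vertex has second coordinate at most 0, so its first exceeds 1/2 and all first
  coordinates exceed -1/2. The same holds for the second ones. Then both coordinates have a positive
  sum at each vertex, although the weighted mean of these sums is 0.\<close>

lemma convex_quadrant:
  assumes l: "0 \<le> l1" "0 \<le> l2" "0 \<le> l3" "l1 + l2 + l3 = (1::real)"
    and u: "l1 * u1 + l2 * u2 + l3 * u3 = 0" and v: "l1 * v1 + l2 * v2 + l3 * v3 = 0"
    and d: "\<bar>u1 - u2\<bar> \<le> 1" "\<bar>u1 - u3\<bar> \<le> 1" "\<bar>u2 - u3\<bar> \<le> 1"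
      "\<bar>v1 - v2\<bar> \<le> 1" "\<bar>v1 - v3\<bar> \<le> 1" "\<bar>v2 - v3\<bar> \<le> 1"
    and out: "1/2 < u1 \<or> 1/2 < v1" "1/2 < u2 \<or> 1/2 < v2" "1/2 < u3 \<or> 1/2 < v3"
  shows False
proof -
  have d': "u1 \<le> u2 + 1" "u2 \<le> u1 + 1" "u1 \<le> u3 + 1" "u3 \<le> u1 + 1" "u2 \<le> u3 + 1" "u3 \<le> u2 + 1"
    "v1 \<le> v2 + 1" "v2 \<le> v1 + 1" "v1 \<le> v3 + 1" "v3 \<le> v1 + 1" "v2 \<le> v3 + 1" "v3 \<le> v2 + 1"
    using d by (simp_all add: abs_le_iff)
  have pos: "w1 \<le> 0 \<or> w2 \<le> 0 \<or> w3 \<le> 0" if "l1 * w1 + l2 * w2 + l3 * w3 = 0" for w1 w2 w3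
  proof (rule ccontr)
    assume "\<not> ?thesis"
    then have w: "0 < w1" "0 < w2" "0 < w3" by auto
    then have "0 \<le> l1 * w1" "0 \<le> l2 * w2" "0 \<le> l3 * w3" using l by auto
    then have "l1 * w1 = 0" "l2 * w2 = 0" "l3 * w3 = 0" using that by linarith+
    then show False using w l(4) by simp
  qed
  have "l1 * (u1 + v1) + l2 * (u2 + v2) + l3 * (u3 + v3) = 0" using u v by (simp add: algebra_simps)
  then have k: "u1 + v1 \<le> 0 \<or> u2 + v2 \<le> 0 \<or> u3 + v3 \<le> 0" by (rule pos)
  note ku = pos[OF u] and kv = pos[OF v]
  have "1/2 < u1 \<or> 1/2 < u2 \<or> 1/2 < u3" using out kv by auto
  then have "- 1/2 < u1" "- 1/2 < u2" "- 1/2 < u3" using d' by auto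
  moreover have "1/2 < v1 \<or> 1/2 < v2 \<or> 1/2 < v3" using out ku by auto
  then have "- 1/2 < v1" "- 1/2 < v2" "- 1/2 < v3" using d' by auto
  ultimately have "0 < u1 + v1" "0 < u2 + v2" "0 < u3 + v3" using out by auto
  then show False using k by linarith
qed

text \<open>If all vertices lie outside, differences of at most 1 prevent two of them from lying
  beyond opposite sides. So two adjacent sides account for all three vertices, which
  \<open>convex_quadrant\<close> excludes after sign changes.\<close>

lemma convex_frame:
  assumes l: "0 \<le> l1" "0 \<le> l2" "0 \<le> l3" "l1 + l2 + l3 = (1::real)"
    and u: "l1 * u1 + l2 * u2 + l3 * u3 = 0" and v: "l1 * v1 + l2 * v2 + l3 * v3 = 0"
    and d: "\<bar>u1 - u2\<bar> \<le> 1" "\<bar>u1 - u3\<bar> \<le> 1" "\<bar>u2 - u3\<bar> \<le> 1"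
      "\<bar>v1 - v2\<bar> \<le> 1" "\<bar>v1 - v3\<bar> \<le> 1" "\<bar>v2 - v3\<bar> \<le> 1"
  shows "\<bar>u1\<bar> \<le> 1/2 \<and> \<bar>v1\<bar> \<le> 1/2 \<or> \<bar>u2\<bar> \<le> 1/2 \<and> \<bar>v2\<bar> \<le> 1/2 \<or> \<bar>u3\<bar> \<le> 1/2 \<and> \<bar>v3\<bar> \<le> 1/2"
proof (rule ccontr)
  assume neg: "\<not> ?thesis"
  have d': "u1 \<le> u2 + 1" "u2 \<le> u1 + 1" "u1 \<le> u3 + 1" "u3 \<le> u1 + 1" "u2 \<le> u3 + 1" "u3 \<le> u2 + 1"
    "v1 \<le> v2 + 1" "v2 \<le> v1 + 1" "v1 \<le> v3 + 1" "v3 \<le> v1 + 1" "v2 \<le> v3 + 1" "v3 \<le> v2 + 1"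
    using d by (simp_all add: abs_le_iff)
  have m: "l1 * (- u1) + l2 * (- u2) + l3 * (- u3) = 0" "l1 * (- v1) + l2 * (- v2) + l3 * (- v3) = 0"
    using u v by auto
  have dm: "\<bar>- u1 - - u2\<bar> \<le> 1" "\<bar>- u1 - - u3\<bar> \<le> 1" "\<bar>- u2 - - u3\<bar> \<le> 1"
    "\<bar>- v1 - - v2\<bar> \<le> 1" "\<bar>- v1 - - v3\<bar> \<le> 1" "\<bar>- v2 - - v3\<bar> \<le> 1"
    using d by (simp_all add: abs_minus_commute)
  have out: "1/2 < u1 \<or> 1/2 < - u1 \<or> 1/2 < v1 \<or> 1/2 < - v1"
    "1/2 < u2 \<or> 1/2 < - u2 \<or> 1/2 < v2 \<or> 1/2 < - v2"
    "1/2 < u3 \<or> 1/2 < - u3 \<or> 1/2 < v3 \<or> 1/2 < - v3"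
    using neg by (auto simp: abs_le_iff)
  have su: "\<not> 1/2 < u1 \<and> \<not> 1/2 < u2 \<and> \<not> 1/2 < u3 \<or> \<not> 1/2 < - u1 \<and> \<not> 1/2 < - u2 \<and> \<not> 1/2 < - u3"
    using d' by auto
  have sv: "\<not> 1/2 < v1 \<and> \<not> 1/2 < v2 \<and> \<not> 1/2 < v3 \<or> \<not> 1/2 < - v1 \<and> \<not> 1/2 < - v2 \<and> \<not> 1/2 < - v3"
    using d' by auto
  have q: "\<not> ((1/2 < u1 \<or> 1/2 < v1) \<and> (1/2 < u2 \<or> 1/2 < v2) \<and> (1/2 < u3 \<or> 1/2 < v3))"
    "\<not> ((1/2 < - u1 \<or> 1/2 < v1) \<and> (1/2 < - u2 \<or> 1/2 < v2) \<and> (1/2 < - u3 \<or> 1/2 < v3))"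
    "\<not> ((1/2 < u1 \<or> 1/2 < - v1) \<and> (1/2 < u2 \<or> 1/2 < - v2) \<and> (1/2 < u3 \<or> 1/2 < - v3))"
    "\<not> ((1/2 < - u1 \<or> 1/2 < - v1) \<and> (1/2 < - u2 \<or> 1/2 < - v2) \<and> (1/2 < - u3 \<or> 1/2 < - v3))"
    using convex_quadrant[OF l u v d] convex_quadrant[OF l m(1) v dm(1-3) d(4-6)]
      convex_quadrant[OF l u m(2) d(1-3) dm(4-6)] convex_quadrant[OF l m dm] by satx+
  show False
    using su sv out q by satx
qed



text \<open>The centre lies in the triangle with apex \<open>(m, A)\<close> and base at height
  \<open>B\<close>. The base may be above or below the apex.\<close>

lemma fan_hit:
  assumes dir: "direction c s" and n: "n1 < n2" "n2 - n1 \<le> 1"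
    and d: "(n1 - m)\<^sup>2 + (B - A)\<^sup>2 \<le> 1" "(n2 - m)\<^sup>2 + (B - A)\<^sup>2 \<le> 1"
    and t: "0 \<le> t" "t \<le> 1" and y: "y = A + t * (B - A)"
    and x: "m + t * (n1 - m) \<le> x" "x \<le> m + t * (n2 - m)"
  shows "hit x y c s m A \<or> hit x y c s n1 B \<or> hit x y c s n2 B"
proof -
  \<comment> \<open>The barycentric weight of \<open>(n2, B)\<close>; the other two weights are
    \<open>1 - t\<close> and \<open>t - w\<close>.\<close>
  define w where "w = (x - m - t * (n1 - m)) / (n2 - n1)"
  have cs: "c\<^sup>2 + s\<^sup>2 = 1" using dir by (simp add: direction_def)
  have xw: "x = m + t * (n1 - m) + w * (n2 - n1)" using n by (simp add: w_def)
  have w0: "0 \<le> w" using x n by (simp add: w_def)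
  have "w * (n2 - n1) \<le> t * (n2 - n1)" using x xw by (simp add: algebra_simps)
  then have wt: "w \<le> t" using n by simp
  define u where "u p q = c * (p - x) + s * (q - y)" for p q
  define v where "v p q = c * (q - y) - s * (p - x)" for p q
  have diff: "\<bar>u p q - u p' q'\<bar> \<le> 1" "\<bar>v p q - v p' q'\<bar> \<le> 1"
    if "(p - p')\<^sup>2 + (q - q')\<^sup>2 \<le> 1" for p q p' q'
    using frame_le[OF cs, of "p - p'" "q - q'" 1] that by (simp_all add: u_def v_def algebra_simps)
  have b: "(n1 - n2)\<^sup>2 + (B - B)\<^sup>2 \<le> 1" using n by (simp add: abs_square_le_1)
  have d': "(m - n1)\<^sup>2 + (A - B)\<^sup>2 \<le> 1" "(m - n2)\<^sup>2 + (A - B)\<^sup>2 \<le> 1"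
    using d by (simp_all add: power2_commute)
  have cu: "(1 - t) * u m A + (t - w) * u n1 B + w * u n2 B = 0"
    unfolding u_def y xw by algebra
  have cv: "(1 - t) * v m A + (t - w) * v n1 B + w * v n2 B = 0"
    unfolding v_def y xw by algebra
  have l: "0 \<le> 1 - t" "0 \<le> t - w" "0 \<le> w" "1 - t + (t - w) + w = 1" using t w0 wt by auto
  show ?thesis
    using convex_frame[OF l cu cv diff(1)[OF d'(1)] diff(1)[OF d'(2)] diff(1)[OF b]
      diff(2)[OF d'(1)] diff(2)[OF d'(2)] diff(2)[OF b]]
    unfolding hit_def u_def v_def .
qed



section \<open>Squares close to a wall or a corner\<close>

text \<open>
  The square rests above the line \<open>y = 0\<close>, and its centre lies between and below the two points. If it misses
  both, they lie beyond its two upper sides; the two inequalities that say so add up to the negation of \<open>key\<close>.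
\<close>

lemma wall_hit:
  assumes dir: "direction c s" and y0: "(c + s) / 2 \<le> y"
    and m: "0 \<le> m" "m \<le> 1" and x: "x = x1 + m * (x2 - x1)"
    and y: "y \<le> h1 + m * (h2 - h1)"
    and d: "x1 < x2" "(x2 - x1)\<^sup>2 + (h2 - h1)\<^sup>2 \<le> 1"
    and h: "h1 \<le> 1" "h2 \<le> 1" "\<bar>h1 - h2\<bar> \<le> 1/2"
    and key: "(x2 - x1) * (c * s) + c\<^sup>2 * h1 + s\<^sup>2 * h2 \<le> c + s"
  shows "hit x y c s x1 h1 \<or> hit x y c s x2 h2"
proof (rule ccontr)
  assume neg: "\<not> ?thesis"
  note b = direction_bounds[OF dir]
  have cs: "c\<^sup>2 + s\<^sup>2 = 1" using dir by (simp add: direction_def)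
  define l r k1 k2 where lr: "l = x - x1" "r = x2 - x" "k1 = h1 - y" "k2 = h2 - y"
  have l: "l = m * (x2 - x1)" and r: "r = (1 - m) * (x2 - x1)" using x by (auto simp: lr algebra_simps)
  have l0: "0 \<le> l" and r0: "0 \<le> r" using l r m d by auto
  have k: "k1 \<le> 1/2" "k2 \<le> 1/2" using h y0 b(5) by (auto simp: lr)
  have comb: "0 \<le> (1 - m) * k1 + m * k2" using y by (simp add: lr algebra_simps)
  \<comment> \<open>The centre is not above the segment, so one of \<open>k1\<close>,
    \<open>k2\<close> is nonnegative; the other is at most 1/2 smaller.\<close>
  have kl: "-1/2 \<le> k1" "-1/2 \<le> k2"
  proof -
    have "k1 \<ge> 0 \<or> k2 \<ge> 0"
    proof (rule ccontr)
      assume "\<not> ?thesis"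
      then have "k1 < 0" "k2 < 0" by auto
      then have "(1 - m) * k1 \<le> 0" "m * k2 \<le> 0" "m < 1 \<Longrightarrow> (1 - m) * k1 < 0" "0 < m \<Longrightarrow> m * k2 < 0"
        using m by (simp_all add: mult_nonneg_nonpos mult_pos_neg)
      then have "(1 - m) * k1 + m * k2 < 0" using m by linarith
      then show False using comb by simp
    qed
    then show "-1/2 \<le> k1" "-1/2 \<le> k2" using h(3) unfolding lr by linarith+
  qed
  define u1 v1 u2 v2 where uv: "u1 = s * k1 - c * l" "v1 = s * l + c * k1"
    "u2 = c * r + s * k2" "v2 = c * k2 - s * r"
  have out1: "1/2 < \<bar>u1\<bar> \<or> 1/2 < \<bar>v1\<bar>" and out2: "1/2 < \<bar>u2\<bar> \<or> 1/2 < \<bar>v2\<bar>"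
    using neg by (auto simp: hit_def uv lr algebra_simps)
  have "s * k1 \<le> s * (1/2)" "c * k2 \<le> c * (1/2)" "c * (- 1/2) \<le> c * k1" "s * (- 1/2) \<le> s * k2"
    using k kl b(1,2) by (intro mult_left_mono; simp)+
  moreover have "0 \<le> c * l" "0 \<le> s * l" "0 \<le> c * r" "0 \<le> s * r"
    using b(1,2) l0 r0 by auto
  \<comment> \<open>Each point can now be separated from the square by only two of the four
    sides.\<close>
  ultimately have pr: "u1 \<le> 1/2" "- 1/2 \<le> v1" "v2 \<le> 1/2" "- 1/2 \<le> u2"
    using b(3,4) unfolding uv by linarith+
  have "\<bar>c * (x2 - x1) + s * (h2 - h1)\<bar> \<le> 1" "\<bar>c * (h2 - h1) - s * (x2 - x1)\<bar> \<le> 1"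
    using frame_le[OF cs, of "x2 - x1" "h2 - h1" 1] d by simp_all
  then have diff: "\<bar>u2 - u1\<bar> \<le> 1" "\<bar>v2 - v1\<bar> \<le> 1"
    by (simp_all add: uv lr algebra_simps)
  have su: "(1 - m) * u1 + m * u2 = s * ((1 - m) * k1 + m * k2)"
    and sv: "(1 - m) * v1 + m * v2 = c * ((1 - m) * k1 + m * k2)"
    by (simp_all add: uv l r algebra_simps)
  then have nn: "0 \<le> (1 - m) * u1 + m * u2" "0 \<le> (1 - m) * v1 + m * v2" using b comb by auto
  have main: False if "1/2 < v1" "1/2 < u2"
  proof -
    have "c * (1/2) \<le> c * v1" "s * (1/2) \<le> s * u2" using that b(1,2) by (intro mult_left_mono; simp)+
    moreover have "0 < c \<Longrightarrow> c * (1/2) < c * v1" "0 < s \<Longrightarrow> s * (1/2) < s * u2"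
      using that by (intro mult_strict_left_mono; simp)+
    ultimately have "c / 2 + s / 2 < c * v1 + s * u2" using b(1,2,5) by linarith
    also have "\<dots> = (x2 - x1) * (c * s) + c\<^sup>2 * h1 + s\<^sup>2 * h2 - (c\<^sup>2 + s\<^sup>2) * y"
      by (simp add: uv lr power2_eq_square algebra_simps)
    finally show False using key y0 cs by simp
  qed
  \<comment> \<open>The points would lie beyond the two lower sides. As the centre is not above the
    segment, the weighted means \<open>nn\<close> are nonnegative, which forces
    \<open>m = 1/2\<close> and then fails.\<close>
  have neq: False if "u1 < - 1/2" "v2 < - 1/2" "u2 \<le> 1/2" "v1 \<le> 1/2"
  proof -
    have "(1 - m) * u1 \<le> (1 - m) * (- 1/2)" "m * u2 \<le> m * (1/2)"
      "(1 - m) * v1 \<le> (1 - m) * (1/2)" "m * v2 \<le> m * (- 1/2)"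
      using that m by (intro mult_left_mono; simp)+
    then have "0 \<le> (1 - m) * (- 1/2) + m * (1/2)" "0 \<le> (1 - m) * (1/2) + m * (- 1/2)"
      using nn by (meson add_mono order_trans)+
    then have mh: "m = 1/2" by (simp add: field_simps)
    have "0 \<le> 1/2 * u1 + 1/2 * u2" using nn(1) unfolding mh by simp
    then show False using that by linarith
  qed
  have c1: "u1 < - 1/2 \<or> 1/2 < v1" and c2: "v2 < - 1/2 \<or> 1/2 < u2" using out1 out2 pr by linarith+
  show False
  proof (cases "1/2 < v1")
    case True
    then have "1/2 < u2" using c2 diff by linarith
    then show False using True main by simp
  next
    case False
    then have "u1 < - 1/2" "u2 \<le> 1/2" using c1 diff by linarith+
    then show False using False c2 neq by simp
  qed
qed



text \<open>Both offsets from the centre are at most \<open>k\<close>, and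
  \<open>(c + s) * k \<le> 1/2\<close> amounts to \<open>0 \<le> (c + s - 1)^2\<close>.\<close>

lemma corner_hit:
  assumes dir: "direction c s" and x: "(c + s) / 2 \<le> x" "x \<le> p" "p \<le> 1"
    and y: "(c + s) / 2 \<le> y" "y \<le> q" "q \<le> 1"
  shows "hit x y c s p q"
proof -
  note b = direction_bounds[OF dir]
  define k where "k = 1 - (c + s) / 2"
  have d: "0 \<le> p - x" "p - x \<le> k" "0 \<le> q - y" "q - y \<le> k" using x y unfolding k_def by linarith+
  have k: "k \<le> 1/2" using b by (simp add: k_def)
  have "c * (p - x) \<le> c * k" "s * (q - y) \<le> s * k" "c * (q - y) \<le> c * k" "s * (p - x) \<le> s * k"
    using b d by (auto intro: mult_left_mono)
  moreover have "0 \<le> c * (p - x)" "0 \<le> s * (q - y)" "0 \<le> c * (q - y)" "0 \<le> s * (p - x)"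
    using b d by auto
  moreover have "c * k + s * k \<le> 1/2"
  proof -
    have "0 \<le> (c + s - 1)\<^sup>2" by simp
    then show ?thesis by (simp add: k_def power2_eq_square field_simps)
  qed
  moreover have "0 \<le> c * k" "0 \<le> s * k" using b d by auto
  ultimately show ?thesis unfolding hit_def by linarith
qed

section \<open>Squares inside the square of side 6, and rows of points\<close>

text \<open>Since \<open>(c + s) / 2\<close> is half the width of the square in either coordinate
  direction, the bounds say that it is contained in the square of side 6.\<close>

definition fits :: "real \<Rightarrow> real \<Rightarrow> real \<Rightarrow> real \<Rightarrow> bool" where
  "fits x y c s \<longleftrightarrow> direction c s \<and> (c + s) / 2 \<le> x \<and> x \<le> 6 - (c + s) / 2 \<and>
     (c + s) / 2 \<le> y \<and> y \<le> 6 - (c + s) / 2"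

lemma fits_symmetries:
  assumes "fits x y c s"
  shows "fits y x s c" "fits (6 - x) y s c" "fits x (6 - y) s c"
  using assms unfolding fits_def by (auto simp: direction_swap field_simps)

definition five :: "real set" where "five = {1, 2, 3, 4, 5}"

text \<open>
  The outer points stand at distance \<open>0.84\<close> from the walls instead of \<open>1/2\<close>: a wedged square has to reach the
  first two points of such a row.
\<close>

definition six :: "real set" where "six = {21/25, 3/2, 5/2, 7/2, 9/2, 129/25}"

definition meets_row :: "real \<Rightarrow> real \<Rightarrow> real \<Rightarrow> real \<Rightarrow> real set \<Rightarrow> real \<Rightarrow> bool" where
  "meets_row x y c s R q \<longleftrightarrow> (\<exists>p\<in>R. hit x y c s p q)"

lemma row_symmetric: "p \<in> five \<Longrightarrow> 6 - p \<in> five" "p \<in> six \<Longrightarrow> 6 - p \<in> six"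
  by (auto simp: five_def six_def)

lemma meets_row_reflect:
  assumes "\<And>p. p \<in> R \<Longrightarrow> 6 - p \<in> R"
  shows "meets_row (6 - x) y s c R q \<longleftrightarrow> meets_row x y c s R q"
proof
  assume "meets_row (6 - x) y s c R q"
  then obtain p where p: "p \<in> R" "hit (6 - x) y s c p q" by (auto simp: meets_row_def)
  then have "hit x y c s (6 - p) q" using hit_reflect_x[of 6 x y s c "6 - p" q] by simp
  then show "meets_row x y c s R q" using assms p by (auto simp: meets_row_def)
next
  assume "meets_row x y c s R q"
  then obtain p where p: "p \<in> R" "hit x y c s p q" by (auto simp: meets_row_def)
  then have "hit (6 - x) y s c (6 - p) q" by (simp add: hit_reflect_x)
  then show "meets_row (6 - x) y s c R q" using assms p by (auto simp: meets_row_def)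
qed

section \<open>The inequality \<open>key\<close> of \<open>wall_hit\<close> for the three
  configurations in use\<close>

text \<open>In terms of \<open>w\<close> this reduces to \<open>w^2 / 2 \<le> 0.086\<close>. As
  \<open>w\<close> can reach \<open>sqrt 2 - 1\<close>, the height \<open>0.914\<close> is almost
  the largest possible one for spacing 1, namely \<open>sqrt 2 - 1/2\<close>.\<close>

lemma key_flat:
  assumes "direction c s" "d \<le> 1"
  shows "d * (c * s) + c\<^sup>2 * (457/500) + s\<^sup>2 * (457/500) \<le> c + s"
proof -
  note b = direction_bounds[OF assms(1)]
  define w where "w = c + s - 1"
  have "w\<^sup>2 \<le> (207107/500000)\<^sup>2" using b by (intro power_mono) (auto simp: w_def)
  also have "\<dots> \<le> 86/500" by (simp add: power2_eq_square)
  finally have w: "w\<^sup>2 \<le> 86/500" .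
  have "d * (c * s) \<le> 1 * (c * s)" using assms(2) b(1,2) by (intro mult_right_mono) auto
  moreover have "c\<^sup>2 * (457/500) + s\<^sup>2 * (457/500) = 457/500" unfolding b(9) by argo
  moreover have "c * s = w + w\<^sup>2 / 2" using b(8) by (simp add: w_def)
  ultimately show ?thesis using w w_def by linarith
qed

lemma key_square:
  assumes "direction c s" "d \<le> 177/250"
  shows "d * (c * s) + c\<^sup>2 * 1 + s\<^sup>2 * 1 \<le> c + s"
proof -
  note b = direction_bounds[OF assms(1)]
  define w where "w = c + s - 1"
  have w0: "0 \<le> w" "w \<le> 207107/500000" using b by (auto simp: w_def)
  have "w * w \<le> 207107/500000 * w" using w0 by (intro mult_right_mono) auto
  then have w: "w\<^sup>2 \<le> 207107/500000 * w" by (simp add: power2_eq_square)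
  have "d * (c * s) \<le> 177/250 * (c * s)" using assms(2) b(1,2) by (intro mult_right_mono) auto
  also have "\<dots> = 177/250 * (w + w\<^sup>2 / 2)" using b(8) by (simp add: w_def)
  also have "\<dots> \<le> w" using w w0 by simp
  finally have "d * (c * s) \<le> w" .
  moreover have "c\<^sup>2 * 1 + s\<^sup>2 * 1 = 1" using b(9) by simp
  ultimately show ?thesis using w_def by linarith
qed

text \<open>With both points at distance 1 from the wall the spacing \<open>0.866\<close> would be
  too large. Moving one point to \<open>0.84\<close> gains the term
  \<open>4/25 * s^2\<close>.\<close>

lemma key_slanted:
  assumes dir: "direction c s" and d: "d \<le> 433/500"
  shows "d * (c * s) + c\<^sup>2 * 1 + s\<^sup>2 * (21/25) \<le> c + s"
proof -
  note b = direction_bounds[OF dir]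
  define w where "w = c + s - 1"
  have w: "0 \<le> w" "w \<le> 207107/500000" using b by (auto simp: w_def)
  have cs: "c * s = w + w\<^sup>2 / 2" using b(8) by (simp add: w_def)
  have dcs: "d * (c * s) \<le> 433/500 * (c * s)" using d b by (intro mult_right_mono) auto
  have c2: "c\<^sup>2 * 1 + s\<^sup>2 * (21/25) = 1 - 4/25 * s\<^sup>2" using b(9) by simp
  have "433/500 * (w + w\<^sup>2 / 2) \<le> w + 4/25 * s\<^sup>2"
  proof (cases "w \<le> 309/1000")
    \<comment> \<open>Here \<open>0.866 * (1 + w / 2) \<le> 1\<close>, so the gained term is not
      called for. Larger \<open>w\<close> forces \<open>s \<ge> 0.38\<close>, because
      \<open>w \<le> s - s^2 / 2\<close>.\<close>
    case True
    have "w * w \<le> 309/1000 * w" using True w by (intro mult_right_mono) auto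
    then have "w\<^sup>2 \<le> 309/1000 * w" by (simp add: power2_eq_square)
    then have "433/500 * (w + w\<^sup>2 / 2) \<le> w" using w by simp
    moreover have "0 \<le> 4/25 * s\<^sup>2" by simp
    ultimately show ?thesis by linarith
  next
    case False
    have "s\<^sup>2 \<le> 1" using b(9) zero_le_power2[of c] by linarith
    then have "0 \<le> 1 - s\<^sup>2 / 2" by simp
    moreover have "c\<^sup>2 \<le> (1 - s\<^sup>2 / 2)\<^sup>2"
    proof -
      have "(1 - s\<^sup>2 / 2)\<^sup>2 = 1 - s\<^sup>2 + (s\<^sup>2 / 2)\<^sup>2" by (simp add: power2_eq_square field_simps)
      then show ?thesis using b(9) by simp
    qed
    ultimately have "c \<le> 1 - s\<^sup>2 / 2" by (rule power2_le_imp_le[rotated])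
    then have ws: "309/1000 < s - s\<^sup>2 / 2" using False by (simp add: w_def)
    have s: "38/100 \<le> s"
    proof (rule ccontr)
      assume "\<not> ?thesis"
      then have "0 \<le> (38/100 - s) * (1 - (38/100 + s) / 2)" by (intro mult_nonneg_nonneg) auto
      then show False using ws by (simp add: power2_eq_square field_simps)
    qed
    then have "(38/100)\<^sup>2 \<le> s\<^sup>2" by (intro power_mono) auto
    then have s2: "1444/10000 \<le> s\<^sup>2" by (simp add: power2_eq_square)
    have "w * w \<le> 207107/500000 * w" using w by (intro mult_right_mono) auto
    then have "w\<^sup>2 \<le> 207107/500000 * w" by (simp add: power2_eq_square)
    moreover have "433/500 * (w + w\<^sup>2 / 2) = 433/500 * w + 433/1000 * w\<^sup>2" by (simp add: algebra_simps)
    ultimately show ?thesis using s2 w by linarith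
  qed
  then have "433/500 * (c * s) \<le> w + 4/25 * s\<^sup>2" unfolding cs .
  then show ?thesis using dcs c2 w_def by linarith
qed

section \<open>Squares near the boundary and in the strips between two rows\<close>

lemma flat_hit:
  assumes "fits x y c s" "x1 \<le> x" "x \<le> x2" "x1 < x2" "x2 - x1 \<le> 1" "y \<le> 457/500"
  shows "hit x y c s x1 (457/500) \<or> hit x y c s x2 (457/500)"
proof -
  have "(x2 - x1)\<^sup>2 \<le> 1" using assms by (simp add: abs_square_le_1)
  then show ?thesis
    using assms key_flat[of c s "x2 - x1"]
    by (intro wall_hit[where m = "(x - x1) / (x2 - x1)"]) (auto simp: fits_def field_simps)
qed

text \<open>This is \<open>wall_hit\<close> for the left wall, with coordinates exchanged.
  \<open>A\<close> may lie above or below \<open>B\<close>; the order decides which of the two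
  \<open>key\<close> inequalities applies.\<close>

lemma side_hit:
  assumes f: "fits x y c s" and t: "0 \<le> t" "t \<le> 1" and y: "y = A + t * (B - A)"
    and x: "x \<le> p1 + t * (p2 - p1)" and ne: "A \<noteq> B" and d: "(B - A)\<^sup>2 + (p2 - p1)\<^sup>2 \<le> 1"
    and p: "p1 \<le> 1" "p2 \<le> 1" "\<bar>p1 - p2\<bar> \<le> 1/2"
    and key: "\<bar>B - A\<bar> * (c * s) + c\<^sup>2 * p1 + s\<^sup>2 * p2 \<le> c + s"
      "\<bar>B - A\<bar> * (s * c) + s\<^sup>2 * p1 + c\<^sup>2 * p2 \<le> s + c"
  shows "hit x y c s p1 A \<or> hit x y c s p2 B"
proof (cases "A < B")
  case True
  have "hit y x s c A p1 \<or> hit y x s c B p2"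
    using True f t y x d p key(2)
    by (intro wall_hit[where m = t]) (auto simp: fits_def direction_swap add.commute)
  then show ?thesis using hit_transpose by blast
next
  case False
  have "hit y x s c B p2 \<or> hit y x s c A p1"
    using False ne f t y x d p key(1)
    by (intro wall_hit[where m = "1 - t"])
      (auto simp: fits_def direction_swap add.commute algebra_simps power2_commute abs_minus_commute)
  then show ?thesis using hit_transpose by blast
qed

text \<open>The bound \<open>433/500\<close> is just below \<open>sqrt 3 / 2\<close>, so triangles
  with horizontal offsets at most 1/2 have slanted sides at most 1. They cover the strip between its
  outermost slanted edges; beyond these edges the nearby wall helps, by
  \<open>side_hit\<close>.\<close>

lemma strip_hit_aux:
  assumes f: "fits x y c s" and t: "0 \<le> t" "t \<le> 1" and y: "y = A + t * (B - A)"
    and ne: "A \<noteq> B" and d: "\<bar>B - A\<bar> \<le> 433/500"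
  shows "meets_row x y c s five A \<or> meets_row x y c s six B"
proof -
  have dir: "direction c s" "direction s c" using f by (auto simp: fits_def direction_swap)
  have "\<bar>B - A\<bar>\<^sup>2 \<le> (433/500)\<^sup>2" using d by (intro power_mono) auto
  then have d2: "(B - A)\<^sup>2 \<le> 187489/250000" "(A - B)\<^sup>2 \<le> 187489/250000"
    by (simp_all add: power2_eq_square algebra_simps)
  have y': "y = B + (1 - t) * (A - B)" using y by (simp add: algebra_simps)
  have left: "hit x' y c' s' 1 A \<or> hit x' y c' s' (21/25) B"
    if "fits x' y c' s'" "x' \<le> 1 + t * (21/25 - 1)" for x' c' s'
  proof -
    have "direction c' s'" "direction s' c'" using that by (auto simp: fits_def direction_swap)
    then show ?thesis
      using that t y ne d2 key_slanted[of c' s' "\<bar>B - A\<bar>"] key_slanted[of s' c' "\<bar>B - A\<bar>"] d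
      by (intro side_hit[where t = t]) (auto simp: power2_eq_square)
  qed
  have up: "hit x y c s m A \<or> hit x y c s n1 B \<or> hit x y c s n2 B"
    if "m + t * (n1 - m) \<le> x" "x \<le> m + t * (n2 - m)" "n1 < n2" "n2 - n1 \<le> 1" "\<bar>n1 - m\<bar> \<le> 1/2" "\<bar>n2 - m\<bar> \<le> 1/2" for m n1 n2
  proof -
    have "\<bar>n1 - m\<bar>\<^sup>2 \<le> (1/2)\<^sup>2" "\<bar>n2 - m\<bar>\<^sup>2 \<le> (1/2)\<^sup>2" using that by (intro power_mono; simp)+
    then show ?thesis using that dir t y d2 by (intro fan_hit[where t = t]) (auto simp: power2_eq_square)
  qed
  have down: "hit x y c s m B \<or> hit x y c s n1 A \<or> hit x y c s n2 A"
    if "m + (1 - t) * (n1 - m) \<le> x" "x \<le> m + (1 - t) * (n2 - m)" "n1 < n2" "n2 - n1 \<le> 1" "\<bar>n1 - m\<bar> \<le> 1/2" "\<bar>n2 - m\<bar> \<le> 1/2" for m n1 n2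
  proof -
    have "\<bar>n1 - m\<bar>\<^sup>2 \<le> (1/2)\<^sup>2" "\<bar>n2 - m\<bar>\<^sup>2 \<le> (1/2)\<^sup>2" using that by (intro power_mono; simp)+
    then show ?thesis using that dir t y' d2 by (intro fan_hit[where t = "1 - t"]) (auto simp: power2_eq_square)
  qed
  \<comment> \<open>The breakpoints are the abscissas at which the height \<open>y\<close> crosses
    the slanted edges, so triangles with apex in \<open>five\<close> and in \<open>six\<close>
    alternate.\<close>
  consider "x \<le> 1 - t * 4/25" | "1 - t * 4/25 \<le> x" "x \<le> 1 + t/2" | "1 + t/2 \<le> x" "x \<le> 2 - t/2"
    | "2 - t/2 \<le> x" "x \<le> 2 + t/2" | "2 + t/2 \<le> x" "x \<le> 3 - t/2" | "3 - t/2 \<le> x" "x \<le> 3 + t/2"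
    | "3 + t/2 \<le> x" "x \<le> 4 - t/2" | "4 - t/2 \<le> x" "x \<le> 4 + t/2" | "4 + t/2 \<le> x" "x \<le> 5 - t/2"
    | "5 - t/2 \<le> x" "x \<le> 5 + t * 4/25" | "5 + t * 4/25 \<le> x" by linarith
  then show ?thesis
  proof cases
    case 1 then show ?thesis using left[OF f] by (auto simp: meets_row_def five_def six_def)
  next
    case 2 then show ?thesis using up[of 1 "21/25" "3/2"] by (auto simp: meets_row_def five_def six_def)
  next
    case 3 then show ?thesis using down[of "3/2" 1 2] by (auto simp: meets_row_def five_def six_def field_simps)
  next
    case 4 then show ?thesis using up[of 2 "3/2" "5/2"] by (auto simp: meets_row_def five_def six_def)
  next
    case 5 then show ?thesis using down[of "5/2" 2 3] by (auto simp: meets_row_def five_def six_def field_simps)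
  next
    case 6 then show ?thesis using up[of 3 "5/2" "7/2"] by (auto simp: meets_row_def five_def six_def)
  next
    case 7 then show ?thesis using down[of "7/2" 3 4] by (auto simp: meets_row_def five_def six_def field_simps)
  next
    case 8 then show ?thesis using up[of 4 "7/2" "9/2"] by (auto simp: meets_row_def five_def six_def)
  next
    case 9 then show ?thesis using down[of "9/2" 4 5] by (auto simp: meets_row_def five_def six_def field_simps)
  next
    case 10 then show ?thesis using up[of 5 "9/2" "129/25"] by (auto simp: meets_row_def five_def six_def)
  next
    case 11
    then have "hit (6 - x) y s c 1 A \<or> hit (6 - x) y s c (21/25) B"
      using left[OF fits_symmetries(2)[OF f]] by simp
    then have "hit x y c s 5 A \<or> hit x y c s (129/25) B"
      using hit_reflect_x[of 6 x y s c 5 A] hit_reflect_x[of 6 x y s c "129/25" B] by simp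
    then show ?thesis by (auto simp: meets_row_def five_def six_def)
  qed
qed

lemma strip_hit:
  assumes "fits x y c s" "A \<le> y" "y \<le> B" "A < B" "B - A \<le> 433/500"
  shows "meets_row x y c s five A \<or> meets_row x y c s six B"
    "meets_row x y c s six A \<or> meets_row x y c s five B"
  using assms strip_hit_aux[of x y c s "(y - A) / (B - A)" A B]
    strip_hit_aux[of x y c s "(B - y) / (B - A)" B A]
  by (auto simp: field_simps)

text \<open>Between neighbours on the lowest line \<open>flat_hit\<close> applies; outside the
  outermost points the square sits in a corner.\<close>

lemma bottom_hit:
  assumes f: "fits x y c s" and y: "y \<le> 457/500"
  shows "meets_row x y c s five (457/500)" "meets_row x y c s six (457/500)"
proof -
  have left: "hit x' y c' s' p (457/500)" if "fits x' y c' s'" "x' \<le> p" "p \<le> 1" for x' c' s' p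
    using that y by (intro corner_hit) (auto simp: fits_def)
  have right: "hit x y c s p (457/500)" if "p \<le> x" "5 \<le> p" for p
    using left[OF fits_symmetries(2)[OF f], of "6 - p"] that hit_reflect_x[of 6 x y s c p "457/500"] by auto
  note flat = flat_hit[OF f _ _ _ _ y]
  consider "x \<le> 1" | "1 \<le> x" "x \<le> 2" | "2 \<le> x" "x \<le> 3" | "3 \<le> x" "x \<le> 4" | "4 \<le> x" "x \<le> 5" | "5 \<le> x"
    by linarith
  then show "meets_row x y c s five (457/500)"
    by cases (use left[OF f, of 1] right[of 5] flat[of 1 2] flat[of 2 3] flat[of 3 4] flat[of 4 5]
        in \<open>auto simp: meets_row_def five_def\<close>)
  consider "x \<le> 21/25" | "21/25 \<le> x" "x \<le> 3/2" | "3/2 \<le> x" "x \<le> 5/2" | "5/2 \<le> x" "x \<le> 7/2"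
    | "7/2 \<le> x" "x \<le> 9/2" | "9/2 \<le> x" "x \<le> 129/25" | "129/25 \<le> x"
    by linarith
  then show "meets_row x y c s six (457/500)"
    by cases (use left[OF f, of "21/25"] right[of "129/25"] flat[of "21/25" "3/2"] flat[of "3/2" "5/2"]
        flat[of "5/2" "7/2"] flat[of "7/2" "9/2"] flat[of "9/2" "129/25"]
        in \<open>auto simp: meets_row_def six_def\<close>)
qed

lemma top_hit:
  assumes f: "fits x y c s" and y: "2543/500 \<le> y"
  shows "meets_row x y c s five (2543/500)" "meets_row x y c s six (2543/500)"
  using bottom_hit[OF fits_symmetries(3)[OF f]] y hit_reflect_y[of x 6 y s c _ "2543/500"]
  by (auto simp: meets_row_def)

section \<open>The arrangements of 33 and 32 points\<close>

definition meets :: "real \<Rightarrow> real \<Rightarrow> real \<Rightarrow> real \<Rightarrow> (real \<times> real) set \<Rightarrow> bool" where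
  "meets x y c s P \<longleftrightarrow> (\<exists>(p, q)\<in>P. hit x y c s p q)"

text \<open>The extreme heights \<open>457/500\<close> and \<open>2543/500\<close> are mirror
  images. The four upper gaps have the full size \<open>433/500\<close>, and the lowest one takes
  the remainder \<open>354/500\<close>.\<close>

definition rows :: "real set \<Rightarrow> real set \<Rightarrow> real set \<Rightarrow> real set \<Rightarrow> real set \<Rightarrow> real set \<Rightarrow> (real \<times> real) set" where
  "rows R1 R2 R3 R4 R5 R6 = R1 \<times> {457/500} \<union> R2 \<times> {811/500} \<union> R3 \<times> {1244/500} \<union>
     R4 \<times> {1677/500} \<union> R5 \<times> {2110/500} \<union> R6 \<times> {2543/500}"

lemma meets_rows:
  "meets x y c s (rows R1 R2 R3 R4 R5 R6) \<longleftrightarrow>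
    meets_row x y c s R1 (457/500) \<or> meets_row x y c s R2 (811/500) \<or> meets_row x y c s R3 (1244/500) \<or>
    meets_row x y c s R4 (1677/500) \<or> meets_row x y c s R5 (2110/500) \<or> meets_row x y c s R6 (2543/500)"
  unfolding meets_def meets_row_def rows_def by blast

lemma finite_rows: "finite five" "finite six" by (auto simp: five_def six_def)

lemma card_rows: "card five = 5" "card six = 6" by (auto simp: five_def six_def)

lemma card_rows_le:
  "card (rows R1 R2 R3 R4 R5 R6) \<le> card R1 + card R2 + card R3 + card R4 + card R5 + card R6"
proof -
  have "card (rows R1 R2 R3 R4 R5 R6) \<le> card (R1 \<times> {457/500::real}) + card (R2 \<times> {811/500::real}) +
    card (R3 \<times> {1244/500::real}) + card (R4 \<times> {1677/500::real}) + card (R5 \<times> {2110/500::real}) + card (R6 \<times> {2543/500::real})"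
    unfolding rows_def by (intro order_trans[OF card_Un_le] add_right_mono order_refl)
  then show ?thesis by (simp add: card_cartesian_product)
qed

abbreviation "five_first \<equiv> rows five six five six five six"
abbreviation "six_first \<equiv> rows six five six five six five"
abbreviation "five_twice \<equiv> rows five five six five six five"

lemma height_cases:
  fixes y :: real
  obtains "y \<le> 457/500" | "457/500 \<le> y" "y \<le> 811/500" | "811/500 \<le> y" "y \<le> 1244/500"
    | "1244/500 \<le> y" "y \<le> 1677/500" | "1677/500 \<le> y" "y \<le> 2110/500" | "2110/500 \<le> y" "y \<le> 2543/500"
    | "2543/500 \<le> y"
  by linarith

lemma five_first_unavoidable:
  assumes f: "fits x y c s"
  shows "meets x y c s five_first"
  unfolding meets_rows
  by (cases y rule: height_cases)
    (use bottom_hit[OF f] top_hit[OF f] strip_hit[OF f, of "457/500" "811/500"]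
        strip_hit[OF f, of "811/500" "1244/500"] strip_hit[OF f, of "1244/500" "1677/500"]
        strip_hit[OF f, of "1677/500" "2110/500"] strip_hit[OF f, of "2110/500" "2543/500"] in auto)

lemma six_first_unavoidable:
  assumes f: "fits x y c s"
  shows "meets x y c s six_first"
  unfolding meets_rows
  by (cases y rule: height_cases)
    (use bottom_hit[OF f] top_hit[OF f] strip_hit[OF f, of "457/500" "811/500"]
        strip_hit[OF f, of "811/500" "1244/500"] strip_hit[OF f, of "1244/500" "1677/500"]
        strip_hit[OF f, of "1677/500" "2110/500"] strip_hit[OF f, of "2110/500" "2543/500"] in auto)

text \<open>The rows alternate except across the lowest gap, so the centre must be there. That gap
  is small enough for \<open>key_square\<close>: near a side wall, one of the two outermost points
  at distance 1 from it is hit.\<close>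

lemma five_twice_avoided:
  assumes f: "fits x y c s" and av: "\<not> meets x y c s five_twice"
  shows "457/500 \<le> y" "y \<le> 811/500" "1 \<le> x" "x \<le> 5"
proof -
  have y: "457/500 \<le> y \<and> y \<le> 811/500"
    by (cases y rule: height_cases)
      (use av bottom_hit[OF f] top_hit[OF f] strip_hit[OF f, of "811/500" "1244/500"]
        strip_hit[OF f, of "1244/500" "1677/500"] strip_hit[OF f, of "1677/500" "2110/500"]
        strip_hit[OF f, of "2110/500" "2543/500"] in \<open>auto simp: meets_rows\<close>)
  then show "457/500 \<le> y" "y \<le> 811/500" by auto
  have side: "hit x' y c' s' 1 (457/500) \<or> hit x' y c' s' 1 (811/500)" if "fits x' y c' s'" "x' \<le> 1" for x' c' s'
  proof -
    have "direction c' s'" "direction s' c'" using that by (auto simp: fits_def direction_swap)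
    then show ?thesis
      using that y key_square[of c' s' "177/250"] key_square[of s' c' "177/250"]
      by (intro side_hit[where t = "(y - 457/500) / (177/250)"]) (auto simp: power2_eq_square field_simps)
  qed
  show "1 \<le> x"
    using side[OF f] av by (fastforce simp: meets_rows meets_row_def five_def)
  show "x \<le> 5"
    using side[OF fits_symmetries(2)[OF f]] hit_reflect_x[of 6 x y s c 5] av
    by (fastforce simp: meets_rows meets_row_def five_def)
qed

section \<open>A square wedged between the corners of a rectangle\<close>

definition outside :: "real \<Rightarrow> real \<Rightarrow> real \<Rightarrow> real \<Rightarrow> bool" where
  "outside c s p q \<longleftrightarrow> 1/2 < \<bar>c * p + s * q\<bar> \<or> 1/2 < \<bar>c * q - s * p\<bar>"

text \<open>\<open>(a, b)\<close> is the centre of the square relative to that of a rectangle of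
  size \<open>1\<close> by \<open>177/250\<close> with all corners outside the square. If the upper
  right corner were beyond any side other than the one in direction \<open>(c, s)\<close>, following
  the other corners around would be contradictory.\<close>

lemma slot_corner:
  assumes dir: "direction c s" and ab: "\<bar>a\<bar> \<le> 1/2" "\<bar>b\<bar> \<le> 177/500"
    and ne: "outside c s (1/2 - a) (177/500 - b)" and nw: "outside c s (- 1/2 - a) (177/500 - b)"
    and se: "outside c s (1/2 - a) (- 177/500 - b)" and sw: "outside c s (- 1/2 - a) (- 177/500 - b)"
  shows "1/2 < c * (1/2 - a) + s * (177/500 - b)"
proof (rule ccontr)
  assume neg: "\<not> ?thesis"
  note d = direction_bounds[OF dir]
  define P Q R T where def: "P = 1/2 - a" "Q = 1/2 + a" "R = 177/500 - b" "T = 177/500 + b"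
  have nn: "0 \<le> P" "0 \<le> Q" "0 \<le> R" "0 \<le> T" using ab unfolding def by linarith+
  have sum: "P + Q = 1" "R + T = 177/250" by (auto simp: def)
  have pos: "0 \<le> c * P" "0 \<le> c * Q" "0 \<le> c * R" "0 \<le> c * T" "0 \<le> s * P" "0 \<le> s * Q" "0 \<le> s * R" "0 \<le> s * T"
    using nn d(1,2) by auto
  have le: "c * Q \<le> Q" "s * Q \<le> Q" "c * R \<le> R" "s * R \<le> R" "c * T \<le> T" "s * T \<le> T" "s * P \<le> P"
    using nn d(1-4) by (simp_all add: mult_left_le_one_le)
  have "c * (P + Q) = c" "s * (P + Q) = s" "c * (R + T) = 177/250 * c" "s * (R + T) = 177/250 * s"
    unfolding sum by auto
  then have sums: "c * P + c * Q = c" "s * P + s * Q = s" "c * R + c * T = 177/250 * c" "s * R + s * T = 177/250 * s"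
    by (simp_all only: distrib_left)
  \<comment> \<open>Multiplying by \<open>s\<close> and \<open>c\<close> and using
    \<open>P + Q = 1\<close> gives \<open>c + s \<le> 2 * (c * s) \<le> 1\<close>. Hence
    \<open>c + s = 1\<close> and \<open>c * s = 0\<close>, which is absurd.\<close>
  have mix: False if "1/2 < c * P" "1/2 < s * Q"
  proof -
    have "s * (1/2) \<le> s * (c * P)" "c * (1/2) \<le> c * (s * Q)" using that d(1,2) by (intro mult_left_mono; simp)+
    moreover have "s * (c * P) + c * (s * Q) = c * s * (P + Q)" by (simp add: algebra_simps)
    ultimately have h: "c + s \<le> 2 * (c * s)" using sum by simp
    have "2 * (c * s) \<le> 1" using d(6) by simp
    then have "c + s = 1" using order_trans[OF h] d(5) by fastforce
    then show False using h d(8) by simp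
  qed
  have eqs: "c * (- 1/2 - a) + s * (177/500 - b) = s * R - c * Q" "c * (177/500 - b) - s * (- 1/2 - a) = c * R + s * Q"
    "c * (1/2 - a) + s * (- 177/500 - b) = c * P - s * T" "c * (- 177/500 - b) - s * (1/2 - a) = - (c * T + s * P)"
    "c * (- 1/2 - a) + s * (- 177/500 - b) = - (c * Q + s * T)" "c * (- 177/500 - b) - s * (- 1/2 - a) = s * Q - c * T"
    by (simp_all add: def algebra_simps)
  have split: "1/2 < \<bar>t\<bar> \<longleftrightarrow> 1/2 < t \<or> t < - 1/2" for t :: real by linarith
  have NE: "1/2 < c * P + s * R \<or> c * P + s * R < - 1/2 \<or> 1/2 < c * R - s * P \<or> c * R - s * P < - 1/2"
    using ne unfolding outside_def split def(1,3)[symmetric] by blast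
  have NW: "1/2 < s * R - c * Q \<or> s * R - c * Q < - 1/2 \<or> 1/2 < c * R + s * Q \<or> c * R + s * Q < - 1/2"
    using nw unfolding outside_def eqs split by blast
  have SE: "1/2 < c * P - s * T \<or> c * P - s * T < - 1/2 \<or> 1/2 < c * T + s * P \<or> c * T + s * P < - 1/2"
    using se unfolding outside_def eqs split abs_minus_cancel by blast
  have SW: "1/2 < c * Q + s * T \<or> c * Q + s * T < - 1/2 \<or> 1/2 < s * Q - c * T \<or> s * Q - c * T < - 1/2"
    using sw unfolding outside_def eqs split abs_minus_cancel by blast
  have u: "c * P + s * R \<le> 1/2" using neg by (simp add: def)
  have "\<not> c * P + s * R < - 1/2" using pos by linarith
  then consider "1/2 < c * R - s * P" | "1/2 < s * P - c * R" using NE u by linarith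
  then show False
  proof cases
    \<comment> \<open>The upper right corner is beyond the side in direction \<open>(-s, c)\<close>.
      Then the lower right one is beyond the side in direction \<open>(c, s)\<close> and the lower
      left one beyond the former side again, which \<open>mix\<close> refutes.\<close>
    case 1
    then have small: "c * T + s * P < 1/2" "T < 1/2" using pos le sum sums d(3) by linarith+
    have "\<not> c * P - s * T < - 1/2" "\<not> c * T + s * P < - 1/2" using small pos le by linarith+
    then have u1: "1/2 < c * P - s * T" using SE small by linarith
    have "\<not> 1/2 < c * Q + s * T" "\<not> c * Q + s * T < - 1/2" "\<not> s * Q - c * T < - 1/2"
      using u1 small pos sums d(3) by linarith+
    then have "1/2 < s * Q - c * T" using SW by linarith
    then have "1/2 < c * P" "1/2 < s * Q" using u1 pos by linarith+
    then show False by (rule mix)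
  next
    \<comment> \<open>The upper right corner is beyond the side in direction \<open>(s, -c)\<close>.
      Then the two left corners are beyond opposite sides, although they are only
      \<open>177/250\<close> apart.\<close>
    case 2
    then have small: "s * Q + c * R < 1/2" "Q < 1/2" using sums le pos d(4) sum by linarith+
    then have "\<not> s * R - c * Q < - 1/2" "\<not> c * R + s * Q < - 1/2" using pos le by linarith+
    then have v1: "1/2 < s * R - c * Q" using NW small by linarith
    have "T < 1/2" using v1 pos le sum by linarith
    then have "\<not> c * Q + s * T < - 1/2" "\<not> 1/2 < s * Q - c * T" "\<not> s * Q - c * T < - 1/2"
      using small pos le by linarith+
    then have "1/2 < c * Q + s * T" using SW by linarith
    then show False using v1 sums d(4) by linarith
  qed
qed

text \<open>
  By \<open>slot_corner\<close> and its mirror images the four corners lie beyond the four different sides, which bounds the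
  position of the centre in the frame of the square; \<open>e\<close>, \<open>f\<close> then enter by the Cauchy-Schwarz inequality.
\<close>

lemma slot_contains:
  assumes dir: "direction c s" and x: "\<bar>x - m\<bar> \<le> 1/2" and y: "\<bar>y - n\<bar> \<le> 177/500"
    and av: "\<not> hit x y c s (m + 1/2) (n + 177/500)" "\<not> hit x y c s (m - 1/2) (n + 177/500)"
      "\<not> hit x y c s (m + 1/2) (n - 177/500)" "\<not> hit x y c s (m - 1/2) (n - 177/500)"
    and ef: "(1/2 + \<bar>e\<bar>)\<^sup>2 + (177/500 + \<bar>f\<bar>)\<^sup>2 \<le> 1"
  shows "hit x y c s (m + e) (n + f)"
proof -
  define a b where ab: "a = x - m" "b = y - n"
  have cs: "c\<^sup>2 + s\<^sup>2 = 1" using dir by (simp add: direction_def)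
  have out: "outside c s (1/2 - a) (177/500 - b)" "outside c s (- 1/2 - a) (177/500 - b)"
    "outside c s (1/2 - a) (- 177/500 - b)" "outside c s (- 1/2 - a) (- 177/500 - b)"
    using av by (simp_all add: outside_def hit_def ab not_le algebra_simps disj_commute)
  have refl: "outside s c (- p) q \<longleftrightarrow> outside c s p q" "outside s c p (- q) \<longleftrightarrow> outside c s p q"
    "outside c s (- p) (- q) \<longleftrightarrow> outside c s p q" for p q
  proof -
    have "s * (- p) + c * q = c * q - s * p" "c * (- p) + s * q = - (c * p - s * q)"
      "s * q - c * (- p) = c * p + s * q" "s * p + c * (- q) = - (c * q - s * p)"
      "s * (- q) - c * p = - (c * p + s * q)" "c * (- p) + s * (- q) = - (c * p + s * q)"
      "c * (- q) - s * (- p) = - (c * q - s * p)" by (simp_all add: algebra_simps)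
    then show "outside s c (- p) q \<longleftrightarrow> outside c s p q" "outside s c p (- q) \<longleftrightarrow> outside c s p q"
      "outside c s (- p) (- q) \<longleftrightarrow> outside c s p q"
      unfolding outside_def by (simp_all only: abs_minus_cancel disj_commute)
  qed
  have bd: "\<bar>a\<bar> \<le> 1/2" "\<bar>b\<bar> \<le> 177/500" "\<bar>- a\<bar> \<le> 1/2" "\<bar>- b\<bar> \<le> 177/500" using x y by (simp_all add: ab abs_minus_commute)
  have dir': "direction s c" using dir by (simp add: direction_swap)
  have m1: "1/2 - (- a) = - (- 1/2 - a)" "- 1/2 - (- a) = - (1/2 - a)"
    "177/500 - (- b) = - (- 177/500 - b)" "- 177/500 - (- b) = - (177/500 - b)" by auto
  have q: "1/2 < c * (1/2 - a) + s * (177/500 - b)" "1/2 < s * (1/2 - - a) + c * (177/500 - b)"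
    "1/2 < s * (1/2 - a) + c * (177/500 - - b)" "1/2 < c * (1/2 - - a) + s * (177/500 - - b)"
  proof -
    show "1/2 < c * (1/2 - a) + s * (177/500 - b)"
      by (rule slot_corner[OF dir bd(1,2)]) (use out in simp_all)
    show "1/2 < s * (1/2 - - a) + c * (177/500 - b)"
      by (rule slot_corner[OF dir' bd(3,2)]) (unfold m1 refl, use out in simp_all)
    show "1/2 < s * (1/2 - a) + c * (177/500 - - b)"
      by (rule slot_corner[OF dir' bd(1,4)]) (unfold m1 refl, use out in simp_all)
    show "1/2 < c * (1/2 - - a) + s * (177/500 - - b)"
      by (rule slot_corner[OF dir bd(3,4)]) (unfold m1 refl, use out in simp_all)
  qed
  \<comment> \<open>Up to signs, this vector leads from the point \<open>(m + e, n + f)\<close> to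
    the farthest corner of the rectangle; \<open>ef\<close> bounds its length by 1.\<close>
  have t: "\<bar>c * (1/2 + \<bar>e\<bar>) + s * (177/500 + \<bar>f\<bar>)\<bar> \<le> 1" "\<bar>s * (1/2 + \<bar>e\<bar>) + c * (177/500 + \<bar>f\<bar>)\<bar> \<le> 1"
    using frame_le(1)[OF cs, of "1/2 + \<bar>e\<bar>" "177/500 + \<bar>f\<bar>" 1] frame_le(1)[of s c "1/2 + \<bar>e\<bar>" "177/500 + \<bar>f\<bar>" 1] cs ef
    by (simp_all add: add.commute)
  have nn: "0 \<le> c" "0 \<le> s" using direction_bounds[OF dir] by auto
  have ab': "\<bar>c * e\<bar> = c * \<bar>e\<bar>" "\<bar>s * e\<bar> = s * \<bar>e\<bar>" "\<bar>c * f\<bar> = c * \<bar>f\<bar>" "\<bar>s * f\<bar> = s * \<bar>f\<bar>"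
    using nn by (simp_all add: abs_mult)
  have t1: "\<bar>c * e + s * f\<bar> \<le> 1 - c / 2 - s * (177/500)"
    using abs_triangle_ineq[of "c * e" "s * f"] abs_le_D1[OF t(1)] ab' by (simp add: algebra_simps)
  have t2: "\<bar>c * f - s * e\<bar> \<le> 1 - s / 2 - c * (177/500)"
    using abs_triangle_ineq4[of "c * f" "s * e"] abs_le_D1[OF t(2)] ab' by (simp add: algebra_simps)
  have u: "\<bar>c * a + s * b\<bar> \<le> c / 2 + s * (177/500) - 1/2" "\<bar>c * b - s * a\<bar> \<le> s / 2 + c * (177/500) - 1/2"
    using q by (auto simp: abs_le_iff algebra_simps)
  have "\<bar>(c * e + s * f) - (c * a + s * b)\<bar> \<le> 1/2" "\<bar>(c * f - s * e) - (c * b - s * a)\<bar> \<le> 1/2"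
    using abs_triangle_ineq4[of "c * e + s * f" "c * a + s * b"] abs_triangle_ineq4[of "c * f - s * e" "c * b - s * a"]
      t1 t2 u by simp_all
  moreover have "(c * e + s * f) - (c * a + s * b) = c * (e - a) + s * (f - b)"
    "(c * f - s * e) - (c * b - s * a) = c * (f - b) - s * (e - a)" by (simp_all add: algebra_simps)
  moreover have eq: "m + e - x = e - a" "n + f - y = f - b" by (simp_all add: ab)
  ultimately show ?thesis unfolding hit_def eq by metis
qed

section \<open>Counting squares by the points they contain\<close>

lemma card_le_of_disjoint_hits:
  assumes fin: "finite P" and hit: "\<And>i. i \<in> I \<Longrightarrow> \<exists>z\<in>P. h i z"
    and disj: "\<And>i j z. i \<in> I \<Longrightarrow> j \<in> I \<Longrightarrow> h i z \<Longrightarrow> h j z \<Longrightarrow> i = j"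
  shows "card I \<le> card P"
proof -
  obtain g where g: "\<And>i. i \<in> I \<Longrightarrow> g i \<in> P \<and> h i (g i)" using hit by metis
  then have "inj_on g I" using disj by (metis inj_onI)
  then show ?thesis using g fin by (intro card_inj_on_le[of g]) auto
qed

text \<open>Removing \<open>k\<close> costs one index but two points, and the remaining indices
  still hit the remaining points.\<close>

lemma card_less_of_double_hit:
  assumes fin: "finite P" and finI: "finite I" and hit: "\<And>i. i \<in> I \<Longrightarrow> \<exists>z\<in>P. h i z"
    and disj: "\<And>i j z. i \<in> I \<Longrightarrow> j \<in> I \<Longrightarrow> h i z \<Longrightarrow> h j z \<Longrightarrow> i = j"
    and k: "k \<in> I" "z1 \<in> P" "z2 \<in> P" "z1 \<noteq> z2" "h k z1" "h k z2"
  shows "card I < card P"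
proof -
  have "card (I - {k}) \<le> card (P - {z1, z2})"
  proof (rule card_le_of_disjoint_hits[where h = h])
    show "\<exists>z\<in>P - {z1, z2}. h i z" if "i \<in> I - {k}" for i
    proof -
      have i: "i \<in> I" "i \<noteq> k" using that by auto
      obtain z where z: "z \<in> P" "h i z" using hit[OF i(1)] by blast
      have "z \<noteq> z1" "z \<noteq> z2" using disj[OF i(1) k(1) z(2)] k(5,6) i(2) by metis+
      then show ?thesis using z by blast
    qed
  qed (use fin disj in auto)
  moreover have "card (P - {z1, z2}) = card P - 2" "2 \<le> card P"
    using k fin card_Diff_subset[of "{z1, z2}" P] card_mono[OF fin, of "{z1, z2}"] by auto
  moreover have "card (I - {k}) = card I - 1" "0 < card I" using k finI by (auto simp: card_gt_0_iff)
  ultimately show ?thesis by linarith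
qed

lemma finite_card_arrangements:
  "finite five_first" "finite six_first" "finite five_twice"
  "card five_first \<le> 33" "card six_first \<le> 33" "card five_twice \<le> 32"
  using card_rows_le[of five six five six five six] card_rows_le[of six five six five six five]
    card_rows_le[of five five six five six five] finite_rows
  by (auto simp: card_rows rows_def)

locale packing =
  fixes I :: "'a set" and X Y C S :: "'a \<Rightarrow> real"
  assumes finI: "finite I" and fits: "i \<in> I \<Longrightarrow> fits (X i) (Y i) (C i) (S i)"
    and disj: "i \<in> I \<Longrightarrow> j \<in> I \<Longrightarrow> hit (X i) (Y i) (C i) (S i) p q \<Longrightarrow>
      hit (X j) (Y j) (C j) (S j) p q \<Longrightarrow> i = j"
begin

lemma reflected: "packing I (\<lambda>i. 6 - X i) Y S C"
proof
  show "i = j" if "i \<in> I" "j \<in> I" "hit (6 - X i) (Y i) (S i) (C i) p q" "hit (6 - X j) (Y j) (S j) (C j) p q"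
    for i j p q
    using that disj[of i j "6 - p" q] hit_reflect_x[of 6 "X i" "Y i" "S i" "C i" "6 - p" q]
      hit_reflect_x[of 6 "X j" "Y j" "S j" "C j" "6 - p" q] by simp
qed (use finI fits fits_symmetries in auto)

text \<open>The arrangement \<open>P\<close> is used with coordinates exchanged; it stays
  unavoidable because \<open>fits\<close> is invariant under transposition.\<close>

lemma double_hit:
  assumes un: "\<And>x y c s. fits x y c s \<Longrightarrow> meets x y c s P" and P: "finite P" "card P \<le> 33"
    and k: "k \<in> I" "(q1, p) \<in> P" "(q2, p) \<in> P" "q1 \<noteq> q2"
      "hit (X k) (Y k) (C k) (S k) p q1" "hit (X k) (Y k) (C k) (S k) p q2"
  shows "card I < 33"
proof -
  define h where "h i z = hit (Y i) (X i) (S i) (C i) (fst z) (snd z)" for i and z :: "real \<times> real"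
  have "card I < card P"
  proof (rule card_less_of_double_hit[OF P(1) finI _ _ k(1-3), of h])
    show "\<exists>z\<in>P. h i z" if "i \<in> I" for i
      using un[OF fits_symmetries(1)[OF fits[OF that]]] unfolding meets_def h_def split_beta .
    show "i = j" if "i \<in> I" "j \<in> I" "h i z" "h j z" for i j z
      using that disj[OF that(1,2), of "snd z" "fst z"] by (simp add: h_def hit_transpose)
  qed (use k(4-6) in \<open>simp_all add: h_def hit_transpose\<close>)
  then show ?thesis using P by simp
qed

text \<open>The columns \<open>811/500\<close> of the exchanged \<open>five_first\<close> and
  \<open>1244/500\<close> of the exchanged \<open>six_first\<close> carry six points each and cross
  the first and second rectangle, respectively.\<close>

lemma left_half:
  assumes k: "k \<in> I" "\<not> meets (X k) (Y k) (C k) (S k) five_twice" "X k \<le> 3"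
  shows "card I < 33"
proof -
  let ?h = "hit (X k) (Y k) (C k) (S k)"
  note f = fits[OF k(1)]
  note b = five_twice_avoided[OF f k(2)]
  have dir: "direction (C k) (S k)" using f by (simp add: fits_def)
  have av: "\<not> ?h p (457/500)" "\<not> ?h p (811/500)" if "p \<in> five" for p
    using k(2) that by (auto simp: meets_rows meets_row_def)
  have yb: "\<bar>Y k - 317/250\<bar> \<le> 177/500" using b(1,2) by linarith
  show ?thesis
  proof (cases "X k \<le> 2")
    case True
    have "\<bar>X k - 3/2\<bar> \<le> 1/2" using True b(3) by linarith
    note slot = slot_contains[OF dir this yb]
    \<comment> \<open>The offsets start at the rectangle's centre \<open>(3/2, 317/250)\<close>. The
      first one is nearly extremal, \<open>0.622^2 + 0.782^2 = 0.9984\<close>, so the outer points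
      of \<open>six\<close> can hardly be closer to the wall.\<close>
    have "?h (811/500) (21/25)" and "?h (811/500) (3/2)"
      using slot[of "61/500" "- 107/250"] slot[of "61/500" "29/125"] av[of 1] av[of 2]
      by (simp_all add: five_def power2_eq_square)
    moreover have "(21/25, 811/500) \<in> five_first" "(3/2, 811/500) \<in> five_first"
      by (simp_all add: rows_def six_def)
    ultimately show ?thesis
      using double_hit[OF five_first_unavoidable finite_card_arrangements(1,4) k(1)] by force
  next
    case False
    then have "\<bar>X k - 5/2\<bar> \<le> 1/2" using k(3) by linarith
    note slot = slot_contains[OF dir this yb]
    have "?h (1244/500) (21/25)" "?h (1244/500) (3/2)"
      using slot[of "- 6/500" "- 107/250"] slot[of "- 6/500" "29/125"] av[of 2] av[of 3]
      by (simp_all add: five_def power2_eq_square)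
    moreover have "(21/25, 1244/500) \<in> six_first" "(3/2, 1244/500) \<in> six_first"
      by (simp_all add: rows_def six_def)
    ultimately show ?thesis
      using double_hit[OF six_first_unavoidable finite_card_arrangements(2,5) k(1)] by force
  qed
qed

lemma card_less_33: "card I < 33"
proof (cases "\<exists>k\<in>I. \<not> meets (X k) (Y k) (C k) (S k) five_twice")
  case True
  then obtain k where k: "k \<in> I" "\<not> meets (X k) (Y k) (C k) (S k) five_twice" by blast
  show ?thesis
  proof (cases "X k \<le> 3")
    case False
    interpret r: packing I "\<lambda>i. 6 - X i" Y S C by (rule reflected)
    have "\<not> meets (6 - X k) (Y k) (S k) (C k) five_twice"
      using k(2) by (simp add: meets_rows meets_row_reflect row_symmetric)
    then show ?thesis using r.left_half[OF k(1)] False by simp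
  qed (use left_half k in blast)
next
  case False
  then have "card I \<le> card five_twice"
    using finite_card_arrangements(3) disj unfolding meets_def split_beta
    by (intro card_le_of_disjoint_hits[where h = "\<lambda>i z. hit (X i) (Y i) (C i) (S i) (fst z) (snd z)"]) auto
  then show ?thesis using finite_card_arrangements(6) by simp
qed

end

section \<open>From squares in the plane to coordinates\<close>

lemma orthonormal_real2:
  fixes u v :: "real ^ 2"
  assumes "norm u = 1" "norm v = 1" "u \<bullet> v = 0"
  shows "v $ 1 = - (u $ 2) \<and> v $ 2 = u $ 1 \<or> v $ 1 = u $ 2 \<and> v $ 2 = - (u $ 1)"
proof -
  have n: "u $ 1 * u $ 1 + u $ 2 * u $ 2 = 1" "v $ 1 * v $ 1 + v $ 2 * v $ 2 = 1" "u $ 1 * v $ 1 + u $ 2 * v $ 2 = 0"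
    using assms by (simp_all add: norm_eq_1 inner_vec_def sum_2)
  \<comment> \<open>The determinant of the two vectors; its sign selects the orientation.\<close>
  define k where "k = u $ 1 * v $ 2 - u $ 2 * v $ 1"
  have "k * k = 1" using n unfolding k_def by algebra
  then have "k = 1 \<or> k = - 1" by (simp add: square_eq_1_iff)
  moreover have "v $ 1 = - (k * u $ 2)" "v $ 2 = k * u $ 1" using n unfolding k_def by algebra+
  ultimately show ?thesis by auto
qed

lemma orthonormal_expansion:
  fixes u v p :: "real ^ 2"
  assumes "norm u = 1" "norm v = 1" "u \<bullet> v = 0"
  shows "p = (p \<bullet> u) *\<^sub>R u + (p \<bullet> v) *\<^sub>R v"
proof -
  have n: "u $ 1 * u $ 1 + u $ 2 * u $ 2 = 1" using assms by (simp add: norm_eq_1 inner_vec_def sum_2)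
  consider "v $ 1 = - (u $ 2)" "v $ 2 = u $ 1" | "v $ 1 = u $ 2" "v $ 2 = - (u $ 1)"
    using orthonormal_real2[OF assms] by blast
  then have "p $ 1 = (p $ 1 * u $ 1 + p $ 2 * u $ 2) * u $ 1 + (p $ 1 * v $ 1 + p $ 2 * v $ 2) * v $ 1 \<and>
    p $ 2 = (p $ 1 * u $ 1 + p $ 2 * u $ 2) * u $ 2 + (p $ 1 * v $ 1 + p $ 2 * v $ 2) * v $ 2"
  proof cases
    case 1
    show ?thesis unfolding 1 using n by algebra
  next
    case 2
    show ?thesis unfolding 2 using n by algebra
  qed
  then show ?thesis by (simp add: vec_eq_iff forall_2 inner_vec_def sum_2)
qed

lemma interior_unit_square:
  fixes d u v :: "real ^ 2"
  assumes on: "norm u = 1" "norm v = 1" "u \<bullet> v = 0"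
    and z: "0 < (z - d) \<bullet> u" "(z - d) \<bullet> u < 1" "0 < (z - d) \<bullet> v" "(z - d) \<bullet> v < 1"
  shows "z \<in> interior {d + x *\<^sub>R u + y *\<^sub>R v | x y. x \<in> {0..1} \<and> y \<in> {0..1}}"
proof (rule interiorI)
  let ?U = "{z. 0 < (z - d) \<bullet> u} \<inter> {z. (z - d) \<bullet> u < 1} \<inter> {z. 0 < (z - d) \<bullet> v} \<inter> {z. (z - d) \<bullet> v < 1}"
  show "open ?U" by (intro open_Int open_Collect_less continuous_intros)
  show "z \<in> ?U" using z by simp
  show "?U \<subseteq> {d + x *\<^sub>R u + y *\<^sub>R v | x y. x \<in> {0..1} \<and> y \<in> {0..1}}"
  proof
    fix w assume w: "w \<in> ?U"
    have "w = d + ((w - d) \<bullet> u) *\<^sub>R u + ((w - d) \<bullet> v) *\<^sub>R v"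
      using orthonormal_expansion[OF on, of "w - d"] by (simp add: algebra_simps)
    then show "w \<in> {d + x *\<^sub>R u + y *\<^sub>R v | x y. x \<in> {0..1} \<and> y \<in> {0..1}}" using w by force
  qed
qed

text \<open>For coordinates of equal sign, their absolute values give the same direction up to sign.
  Otherwise a quarter turn is made first, which exchanges them.\<close>

lemma ex_direction:
  assumes "a\<^sup>2 + b\<^sup>2 = (1::real)"
  obtains c s where "direction c s" "c + s = \<bar>a\<bar> + \<bar>b\<bar>"
    "\<And>p q r. \<bar>c * p + s * q\<bar> \<le> r \<and> \<bar>c * q - s * p\<bar> \<le> r \<longleftrightarrow> \<bar>a * p + b * q\<bar> \<le> r \<and> \<bar>a * q - b * p\<bar> \<le> r"
proof (cases "0 \<le> a * b")
  case True
  show thesis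
  proof (rule that[of "\<bar>a\<bar>" "\<bar>b\<bar>"])
    show "direction \<bar>a\<bar> \<bar>b\<bar>" using assms by (simp add: direction_def)
    fix p q r :: real
    have "\<bar>a\<bar> = a \<and> \<bar>b\<bar> = b \<or> \<bar>a\<bar> = - a \<and> \<bar>b\<bar> = - b"
      using True by (auto simp: zero_le_mult_iff)
    moreover have "- a * p + - b * q = - (a * p + b * q)" "- a * q - - b * p = - (a * q - b * p)" by auto
    ultimately show "\<bar>\<bar>a\<bar> * p + \<bar>b\<bar> * q\<bar> \<le> r \<and> \<bar>\<bar>a\<bar> * q - \<bar>b\<bar> * p\<bar> \<le> r \<longleftrightarrow> \<bar>a * p + b * q\<bar> \<le> r \<and> \<bar>a * q - b * p\<bar> \<le> r"
      by (metis abs_minus_cancel)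
  qed simp
next
  case False
  show thesis
  proof (rule that[of "\<bar>b\<bar>" "\<bar>a\<bar>"])
    show "direction \<bar>b\<bar> \<bar>a\<bar>" using assms by (simp add: direction_def add.commute)
    fix p q r :: real
    have "\<bar>a\<bar> = a \<and> \<bar>b\<bar> = - b \<or> \<bar>a\<bar> = - a \<and> \<bar>b\<bar> = b"
      using False by (auto simp: mult_less_0_iff not_le)
    moreover have "- b * p + a * q = a * q - b * p" "- b * q - a * p = - (a * p + b * q)"
      "b * p + - a * q = - (a * q - b * p)" "b * q - - a * p = a * p + b * q" by auto
    ultimately show "\<bar>\<bar>b\<bar> * p + \<bar>a\<bar> * q\<bar> \<le> r \<and> \<bar>\<bar>b\<bar> * q - \<bar>a\<bar> * p\<bar> \<le> r \<longleftrightarrow> \<bar>a * p + b * q\<bar> \<le> r \<and> \<bar>a * q - b * p\<bar> \<le> r"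
      by (metis abs_minus_cancel)
  qed simp
qed

text \<open>The centre of \<open>Q\<close> is scaled by \<open>6 / s\<close>, while the side stays
  1. Scaling back shrinks the closed unit square into the interior of \<open>Q\<close>, so squares
  with disjoint interiors become disjoint closed squares.\<close>

lemma unit_square_coordinates:
  fixes d u v :: "real ^ 2"
  assumes on: "norm u = 1" "norm v = 1" "u \<bullet> v = 0" and s: "0 < s" "s < 6"
    and Q: "is_unit_square Q" "Q \<subseteq> {d + x *\<^sub>R u + y *\<^sub>R v | x y. x \<in> {0..s} \<and> y \<in> {0..s}}"
  shows "\<exists>x y c t. fits x y c t \<and>
    (\<forall>p q. hit x y c t p q \<longrightarrow> d + (p * (s / 6)) *\<^sub>R u + (q * (s / 6)) *\<^sub>R v \<in> interior Q)"
proof -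
  obtain e f g where on': "norm f = 1" "norm g = 1" "f \<bullet> g = 0"
    and Qe: "Q = {e + x *\<^sub>R f + y *\<^sub>R g | x y. x \<in> {0..1} \<and> y \<in> {0..1}}"
    using Q(1) by (auto simp: is_square_def)
  define a b where ab: "a = f \<bullet> u" "b = f \<bullet> v"
  have uv: "u \<bullet> u = 1" "v \<bullet> v = 1" "v \<bullet> u = 0" using on by (simp_all add: norm_eq_1 inner_commute)
  have f: "f = a *\<^sub>R u + b *\<^sub>R v" using orthonormal_expansion[OF on, of f] by (simp add: ab)
  have "f \<bullet> f = 1" using on' by (simp add: norm_eq_1)
  then have a1: "a\<^sup>2 + b\<^sup>2 = 1"
    by (simp add: f inner_add_left inner_add_right uv on(3) power2_eq_square)
  define a' b' where ab': "a' = g \<bullet> u" "b' = g \<bullet> v"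
  have g: "g = a' *\<^sub>R u + b' *\<^sub>R v" using orthonormal_expansion[OF on, of g] by (simp add: ab')
  have "g \<bullet> g = 1" using on' by (simp add: norm_eq_1)
  then have b1: "a'\<^sup>2 + b'\<^sup>2 = 1"
    by (simp add: g inner_add_left inner_add_right uv on(3) power2_eq_square)
  have fg: "a * a' + b * b' = 0"
    using on'(3) by (simp add: f g inner_add_left inner_add_right uv on(3) mult.commute)
  have or: "a' = - b \<and> b' = a \<or> a' = b \<and> b' = - a"
  proof -
    define k where "k = a * b' - b * a'"
    have "k * k = 1" using a1 b1 fg unfolding k_def power2_eq_square by algebra
    then have "k = 1 \<or> k = - 1" by (simp add: square_eq_1_iff)
    moreover have "a' = - (k * b)" "b' = k * a" using a1 fg unfolding k_def power2_eq_square by algebra+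
    ultimately show ?thesis by auto
  qed
  obtain c t where dir: "direction c t" and ct: "c + t = \<bar>a\<bar> + \<bar>b\<bar>"
    and norms: "\<And>p q r. \<bar>c * p + t * q\<bar> \<le> r \<and> \<bar>c * q - t * p\<bar> \<le> r \<longleftrightarrow>
      \<bar>a * p + b * q\<bar> \<le> r \<and> \<bar>a * q - b * p\<bar> \<le> r"
    using ex_direction[OF a1] by blast
  define l where "l = 6 / s"
  have l: "1 < l" "l * s = 6" using s by (auto simp: l_def)
  define m n where mn: "m = (e - d) \<bullet> u + (a + a') / 2" "n = (e - d) \<bullet> v + (b + b') / 2"
  have corner: "0 \<le> (e - d) \<bullet> u + x * a + y * a' \<and> (e - d) \<bullet> u + x * a + y * a' \<le> s \<and>
    0 \<le> (e - d) \<bullet> v + x * b + y * b' \<and> (e - d) \<bullet> v + x * b + y * b' \<le> s"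
    if "x \<in> {0..1}" "y \<in> {0..1}" for x y
  proof -
    have "e + x *\<^sub>R f + y *\<^sub>R g \<in> Q" using that Qe by blast
    then obtain x' y' where xy: "x' \<in> {0..s}" "y' \<in> {0..s}" "e + x *\<^sub>R f + y *\<^sub>R g = d + x' *\<^sub>R u + y' *\<^sub>R v"
      using Q(2) by blast
    then have eq: "(e - d) + x *\<^sub>R f + y *\<^sub>R g = x' *\<^sub>R u + y' *\<^sub>R v" by (simp add: algebra_simps)
    have "(e - d) \<bullet> u + x * a + y * a' = x'" "(e - d) \<bullet> v + x * b + y * b' = y'"
      using arg_cong[OF eq, of "\<lambda>z. z \<bullet> u"] arg_cong[OF eq, of "\<lambda>z. z \<bullet> v"]
      by (simp_all add: inner_add_left uv on(3) ab ab')
    then show ?thesis using xy by simp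
  qed
  \<comment> \<open>In each axis direction the extreme vertices of \<open>Q\<close> differ from the
    centre \<open>(m, n)\<close> by half of \<open>\<bar>a\<bar> + \<bar>b\<bar>\<close>.\<close>
  have bounds: "(c + t) / 2 \<le> m" "m \<le> s - (c + t) / 2" "(c + t) / 2 \<le> n" "n \<le> s - (c + t) / 2"
    using corner[of 0 0] corner[of 1 0] corner[of 0 1] corner[of 1 1] or
    unfolding ct mn by (auto simp: abs_if field_simps)
  have "0 \<le> c + t" using direction_bounds(5)[OF dir] by simp
  then have h: "(c + t) / 2 \<le> l * ((c + t) / 2)" using mult_right_mono[of 1 l "(c + t) / 2"] l by simp
  have "l * ((c + t) / 2) \<le> l * m" "l * m \<le> l * (s - (c + t) / 2)"
    "l * ((c + t) / 2) \<le> l * n" "l * n \<le> l * (s - (c + t) / 2)"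
    using bounds l by (intro mult_left_mono; simp)+
  then have fit: "fits (l * m) (l * n) c t"
    using h dir l(2) unfolding fits_def right_diff_distrib by linarith
  have "d + (p * (s / 6)) *\<^sub>R u + (q * (s / 6)) *\<^sub>R v \<in> interior Q" if hit: "hit (l * m) (l * n) c t p q" for p q
  proof -
    define z where "z = d + (p * (s / 6)) *\<^sub>R u + (q * (s / 6)) *\<^sub>R v"
    define P R where PR: "P = p * (s / 6) - m" "R = q * (s / 6) - n"
    have lP: "p - l * m = l * P" "q - l * n = l * R" using s by (simp_all add: PR l_def field_simps)
    have "\<bar>a * (l * P) + b * (l * R)\<bar> \<le> 1/2 \<and> \<bar>a * (l * R) - b * (l * P)\<bar> \<le> 1/2"
      using hit unfolding hit_def norms lP .
    moreover have "a * (l * P) + b * (l * R) = l * (a * P + b * R)" "a * (l * R) - b * (l * P) = l * (a * R - b * P)"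
      by (simp_all add: algebra_simps)
    ultimately have "l * \<bar>a * P + b * R\<bar> \<le> 1/2" "l * \<bar>a * R - b * P\<bar> \<le> 1/2" using l by (simp_all add: abs_mult)
    \<comment> \<open>Strictness comes from \<open>l > 1\<close>, that is, from
      \<open>s < 6\<close>.\<close>
    moreover have "w < 1/2" if "l * w \<le> 1/2" "0 \<le> w" for w
    proof (cases "w = 0")
      case False
      then have "1 * w < l * w" using l that by (intro mult_strict_right_mono) auto
      then show ?thesis using that by simp
    qed simp
    ultimately have small: "\<bar>a * P + b * R\<bar> < 1/2" "\<bar>a * R - b * P\<bar> < 1/2" by simp_all
    have zu: "(z - e) \<bullet> u = P + (a + a') / 2" "(z - e) \<bullet> v = R + (b + b') / 2"
      by (simp_all add: z_def PR mn inner_diff_left inner_add_left uv on(3))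
    have "a * (P + (a + a') / 2) + b * (R + (b + b') / 2) = a * P + b * R + 1/2"
      using a1 fg by (simp add: power2_eq_square field_simps)
    then have zf: "(z - e) \<bullet> f = a * P + b * R + 1/2"
      unfolding zu[symmetric] f by (simp add: inner_add_right)
    have "a' * (P + (a + a') / 2) + b' * (R + (b + b') / 2) = a' * P + b' * R + 1/2"
      using b1 fg by (simp add: power2_eq_square field_simps)
    then have zg: "(z - e) \<bullet> g = a' * P + b' * R + 1/2"
      unfolding zu[symmetric] g by (simp add: inner_add_right)
    have small': "\<bar>a' * P + b' * R\<bar> < 1/2" using small(2) or by (auto simp: algebra_simps abs_minus_commute)
    show ?thesis
      unfolding Qe z_def[symmetric]
      by (rule interior_unit_square[OF on']) (use small(1) small' in \<open>unfold zf zg, linarith+\<close>)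
  qed
  then show ?thesis using fit by blast
qed

theorem theorem9:
  fixes s :: real and S :: "(real ^ 2) set"
  assumes "is_square s S" and "s < 6"
  shows "\<not> (\<exists>P. card P = 33 \<and> (\<forall>Q\<in>P. is_unit_square Q) \<and> non_overlapping P \<and> packed_in P S)"
proof
  assume "\<exists>P. card P = 33 \<and> (\<forall>Q\<in>P. is_unit_square Q) \<and> non_overlapping P \<and> packed_in P S"
  then obtain P where card: "card P = 33" and unit: "\<And>Q. Q \<in> P \<Longrightarrow> is_unit_square Q"
    and disj: "non_overlapping P" and sub: "\<And>Q. Q \<in> P \<Longrightarrow> Q \<subseteq> S"
    by (auto simp: packed_in_def)
  obtain d u v where on: "norm u = 1" "norm v = 1" "u \<bullet> v = 0" and s: "0 < s"
    and S: "S = {d + x *\<^sub>R u + y *\<^sub>R v | x y. x \<in> {0..s} \<and> y \<in> {0..s}}"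
    using assms(1) by (auto simp: is_square_def)
  define R where "R Q x y c t \<longleftrightarrow> fits x y c t \<and>
    (\<forall>p q. hit x y c t p q \<longrightarrow> d + (p * (s / 6)) *\<^sub>R u + (q * (s / 6)) *\<^sub>R v \<in> interior Q)"
    for Q x y c t
  have "\<exists>x y c t. R Q x y c t" if "Q \<in> P" for Q
    unfolding R_def by (rule unit_square_coordinates[OF on s assms(2) unit[OF that] sub[OF that, unfolded S]])
  then obtain X Y C T where R: "\<And>Q. Q \<in> P \<Longrightarrow> R Q (X Q) (Y Q) (C Q) (T Q)" by metis
  then have fit: "fits (X Q) (Y Q) (C Q) (T Q)" if "Q \<in> P" for Q
    using that by (simp add: R_def)
  have int: "d + (p * (s / 6)) *\<^sub>R u + (q * (s / 6)) *\<^sub>R v \<in> interior Q"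
    if "Q \<in> P" "hit (X Q) (Y Q) (C Q) (T Q) p q" for Q p q
    using R[OF that(1)] that(2) unfolding R_def by simp
  interpret packing P X Y C T
  proof
    \<comment> \<open>Infinite sets have \<open>card\<close> 0, so cardinality 33 implies
      finiteness.\<close>
    show "finite P" using card by (simp add: card_ge_0_finite)
    \<comment> \<open>A point hit by both squares, scaled back, would lie in both interiors.\<close>
    show "Q = Q'" if "Q \<in> P" "Q' \<in> P" "hit (X Q) (Y Q) (C Q) (T Q) p q" "hit (X Q') (Y Q') (C Q') (T Q') p q"
      for Q Q' p q
      using int[OF that(1,3)] int[OF that(2,4)] that(1,2) disj
      unfolding non_overlapping_def pairwise_def by blast
  qed (rule fit)
  show False using card_less_33 card by simp
qed

end
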